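(* Let $(y_i,\mathbf{x}_i)$, $i=1,\dots,N$, be data with $y_i\in\{0,1\}$ and $\mathbf{x}_i\in\mathbb{R}^{1\times K}$, and let $R$ be the ramp function, $R(z)=0$ for $z\le 0$, $R(z)=z$ for $0<z<1$, $R(z)=1$ for $z\ge 1$. For $\boldsymbol{\beta}\in\mathbb{R}^K$ put $$\mathbf{s}_i(\boldsymbol{\beta})=-\mathbf{x}_i'\left(y_i-R(\mathbf{x}_i\boldsymbol{\beta})\right)1\{\mathbf{x}_i\boldsymbol{\beta}\in(0,1)\},\qquad \mathbf{A}_i(\boldsymbol{\beta})=\mathbf{x}_i'\mathbf{x}_i\,1\{\mathbf{x}_i\boldsymbol{\beta}\in(0,1)\}.$$ Let $\boldsymbol{\beta}^{\{g\}}\in\mathbb{R}^K$ be such that $\sum_{i=1}^N\mathbf{A}_i(\boldsymbol{\beta}^{\{g\}})$ is invertible, and let $$\boldsymbol{\beta}^{\{g+1\}}=\boldsymbol{\beta}^{\{g\}}-\left[\frac1N\sum_{i=1}^N\mathbf{A}_i(\boldsymbol{\beta}^{\{g\}})\right]^{-1}\frac1N\sum_{i=1}^N\mathbf{s}_i(\boldsymbol{\beta}^{\{g\}})$$ be the next Newton--Raphson iterate for minimizing the nonlinear least squares objective $\frac1N\sum_{i=1}^N(y_i-R(\mathbf{x}_i\boldsymbol{\beta}))^2$. Then $$\boldsymbol{\beta}^{\{g+1\}}=\left[\frac1N\sum_{i=1}^N\mathbf{x}_i'\mathbf{x}_i\,1\{\mathbf{x}_i\boldsymbol{\beta}^{\{g\}}\in(0,1)\}\right]^{-1}\frac1N\sum_{i=1}^N\mathbf{x}_i'y_i\,1\{\mathbf{x}_i\boldsymbol{\beta}^{\{g\}}\in(0,1)\},$$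 that is, $\boldsymbol{\beta}^{\{g+1\}}$ is the ordinary least squares estimator from regressing $y_i$ on $\mathbf{x}_i$ using only the observations $i$ with $\mathbf{x}_i\boldsymbol{\beta}^{\{g\}}\in(0,1)$.
   Context: Vectors $\boldsymbol{\beta}\in\mathbb{R}^K$ are column vectors, so $\mathbf{x}_i\boldsymbol{\beta}$ is a scalar and $\mathbf{x}_i'\mathbf{x}_i$ is a $K\times K$ matrix. $1\{\cdot\}$ is the indicator function. Up to a common factor of $2$, $\mathbf{s}_i$ and $\mathbf{A}_i$ play the role of the gradient and Hessian in $\boldsymbol{\beta}$ of $(y_i-R(\mathbf{x}_i\boldsymbol{\beta}))^2$ (away from points with $\mathbf{x}_i\boldsymbol{\beta}\in\{0,1\}$); they are defined everywhere by the formulas in the claim. *)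

theory Defs
  imports "HOL-Analysis.Analysis"
begin

definition ramp :: "real \<Rightarrow> real" where
  "ramp z = (if z \<le> 0 then 0 else if z < 1 then z else 1)"

text \<open>
  The regressor row of an observation is stored as a vector \<open>x\<close> of type \<open>real ^ 'k\<close>. Hence the
  scalar (row times column) is the inner product \<open>x \<bullet> \<beta>\<close>, the transposed row is
  \<open>x\<close> itself, and the transposed row times the row is \<open>columnvector x ** rowvector x\<close>.

  Away from points with \<open>x \<bullet> \<beta> \<in> {0, 1}\<close>, the next two functions are half the gradient and half the
  Hessian in \<open>\<beta>\<close> of \<open>(y - ramp (x \<bullet> \<beta>))\<^sup>2\<close>; the factors cancel in a Newton step.
\<close>

definition nls_score :: "real ^ 'k \<Rightarrow> real \<Rightarrow> real ^ 'k \<Rightarrow> real ^ 'k" where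
  "nls_score x y \<beta> =
     - (((y - ramp (x \<bullet> \<beta>)) * indicator {0<..<1} (x \<bullet> \<beta>)) *\<^sub>R x)"

definition nls_hessian :: "real ^ 'k \<Rightarrow> real ^ 'k \<Rightarrow> real ^ 'k ^ 'k" where
  "nls_hessian x \<beta> =
     indicator {0<..<1} (x \<bullet> \<beta>) *\<^sub>R
       ((columnvector x :: real ^ 1 ^ 'k) ** (rowvector x :: real ^ 'k ^ 1))"

definition newton_raphson_step ::
    "nat \<Rightarrow> (nat \<Rightarrow> real ^ 'k) \<Rightarrow> (nat \<Rightarrow> real) \<Rightarrow> real ^ 'k \<Rightarrow> real ^ 'k" where
  "newton_raphson_step N x y \<beta> =
     \<beta> - matrix_inv ((1 / real N) *\<^sub>R (\<Sum>i=1..N. nls_hessian (x i) \<beta>))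
         *v ((1 / real N) *\<^sub>R (\<Sum>i=1..N. nls_score (x i) (y i) \<beta>))"

definition is_ols_estimator ::
    "nat set \<Rightarrow> (nat \<Rightarrow> real ^ 'k) \<Rightarrow> (nat \<Rightarrow> real) \<Rightarrow> real ^ 'k \<Rightarrow> bool" where
  "is_ols_estimator S x y b \<longleftrightarrow>
     is_arg_min (\<lambda>c. \<Sum>i\<in>S. (y i - x i \<bullet> c)\<^sup>2) (\<lambda>_. True) b"

end

theory Submission
  imports Defs
begin

text \<open>
  On the active observations the ramp is the identity, so each score is the Hessian applied to
  \<open>\<beta>\<close> minus \<open>y x\<close>. A Newton step therefore cancels \<open>\<beta>\<close> and solves the normal equations of the
  active observations. A solution of the normal equations minimizes the sum of squares by
  Pythagoras, and invertibility of the Hessian makes the minimizer unique.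
\<close>

text \<open>Trades an inverse for a linear system. This serves to cancel the Hessian in the Newton
  step, to read off the normal equations, and to show that the kernel of the Hessian is
  trivial.\<close>

lemma matrix_inv_mult_vector_unique:
  fixes A :: "real ^ 'n ^ 'n"
  assumes "invertible A"
  shows "matrix_inv A *v b = v \<longleftrightarrow> A *v v = b"
proof
  \<comment> \<open>\<open>matrix_inv\<close> is a Hilbert choice; invertibility supplies a witness,
    so the chosen matrix is a two-sided inverse.\<close>
  have inv: "A ** matrix_inv A = mat 1" "matrix_inv A ** A = mat 1"
    using someI_ex[OF assms[unfolded invertible_def]] unfolding matrix_inv_def by auto
  show "matrix_inv A *v b = v \<Longrightarrow> A *v v = b"
    by (metis inv(1) matrix_vector_mul_assoc matrix_vector_mul_lid)
  show "A *v v = b \<Longrightarrow> matrix_inv A *v b = v"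
    by (metis inv(2) matrix_vector_mul_assoc matrix_vector_mul_lid)
qed

lemma sum_matrix_vector_mult:
  fixes A :: "'i \<Rightarrow> real ^ 'n ^ 'm"
  shows "(\<Sum>i\<in>S. A i) *v v = (\<Sum>i\<in>S. A i *v v)"
  by (induction S rule: infinite_finite_induct) (simp_all add: matrix_vector_mult_add_rdistrib)

lemma nls_hessian_mult_vector:
  "nls_hessian x \<beta> *v v = (indicator {0<..<1} (x \<bullet> \<beta>) * (x \<bullet> v)) *\<^sub>R x"
  by (simp add: nls_hessian_def vec_eq_iff matrix_vector_mult_def matrix_matrix_mult_def
      columnvector_def rowvector_def inner_vec_def sum_distrib_left sum_distrib_right mult_ac)

text \<open>Where the indicator is 1, the ramp returns its argument; elsewhere both sides are
  0.\<close>

lemma nls_score_eq_hessian_residual: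
  "nls_score x y \<beta> = nls_hessian x \<beta> *v \<beta> - (y * indicator {0<..<1} (x \<bullet> \<beta>)) *\<^sub>R x"
  unfolding nls_hessian_mult_vector
  by (simp add: nls_score_def ramp_def indicator_def algebra_simps)

text \<open>The assumption is the normal equations for \<open>b\<close>: residuals are orthogonal to
  all fitted directions. Pairing it with \<open>c - b\<close> kills the cross term of the expanded
  square.\<close>

lemma sum_squares_residual_decomp:
  fixes x :: "'i \<Rightarrow> 'a :: real_inner" and y :: "'i \<Rightarrow> real"
  assumes "(\<Sum>i\<in>S. (y i - x i \<bullet> b) *\<^sub>R x i) = 0"
  shows "(\<Sum>i\<in>S. (y i - x i \<bullet> c)\<^sup>2) =
    (\<Sum>i\<in>S. (y i - x i \<bullet> b)\<^sup>2) + (\<Sum>i\<in>S. (x i \<bullet> (c - b))\<^sup>2)"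
proof -
  have "(\<Sum>i\<in>S. (y i - x i \<bullet> b) * (x i \<bullet> (c - b)))
      = (\<Sum>i\<in>S. (y i - x i \<bullet> b) *\<^sub>R x i) \<bullet> (c - b)"
    by (simp add: inner_sum_left)
  then have cross: "(\<Sum>i\<in>S. (y i - x i \<bullet> b) * (x i \<bullet> (c - b))) = 0"
    using assms by simp
  have "(y i - x i \<bullet> c)\<^sup>2 = (y i - x i \<bullet> b)\<^sup>2 + (x i \<bullet> (c - b))\<^sup>2
      - 2 * ((y i - x i \<bullet> b) * (x i \<bullet> (c - b)))" for i
    by (simp add: power2_eq_square algebra_simps)
  then show ?thesis
    using cross by (simp add: sum.distrib sum_subtractf flip: sum_distrib_left)
qed

text \<open>Up to a constant, the objective is the squared distance between the fits of
  \<open>c\<close> and \<open>b\<^sub>0\<close>. Minimizers may still differ by a vector orthogonal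
  to every regressor in \<open>S\<close>.\<close>

lemma is_ols_estimator_iff_same_fit:
  assumes "finite S" and "(\<Sum>i\<in>S. (y i - x i \<bullet> b\<^sub>0) *\<^sub>R x i) = 0"
  shows "is_ols_estimator S x y b \<longleftrightarrow> (\<forall>i\<in>S. x i \<bullet> (b - b\<^sub>0) = 0)"
proof -
  let ?q = "\<lambda>c. \<Sum>i\<in>S. (x i \<bullet> (c - b\<^sub>0))\<^sup>2"
  have "(\<Sum>i\<in>S. (y i - x i \<bullet> b)\<^sup>2) \<le> (\<Sum>i\<in>S. (y i - x i \<bullet> c)\<^sup>2) \<longleftrightarrow> ?q b \<le> ?q c" for c
    using sum_squares_residual_decomp[OF assms(2), of b] sum_squares_residual_decomp[OF assms(2), of c]
    by linarith
  then have "is_ols_estimator S x y b \<longleftrightarrow> (\<forall>c. ?q b \<le> ?q c)"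
    by (simp add: is_ols_estimator_def is_arg_min_linorder)
  also have "\<dots> \<longleftrightarrow> ?q b = 0"
  proof
    assume "\<forall>c. ?q b \<le> ?q c"
    \<comment> \<open>The competitor \<open>b\<^sub>0\<close> has \<open>?q\<close> equal to
      0.\<close>
    then have "?q b \<le> ?q b\<^sub>0" ..
    then show "?q b = 0" by (simp add: order_antisym sum_nonneg)
  qed (simp add: sum_nonneg)
  also have "\<dots> \<longleftrightarrow> (\<forall>i\<in>S. x i \<bullet> (b - b\<^sub>0) = 0)"
    using assms(1) by (simp add: sum_nonneg_eq_0_iff)
  finally show ?thesis .
qed

theorem mainTheorem4:
  fixes N :: nat
    and x :: "nat \<Rightarrow> real ^ 'k"
    and y :: "nat \<Rightarrow> real"
    and \<beta> \<beta>' :: "real ^ 'k"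
  assumes "\<forall>i\<in>{1..N}. y i \<in> {0, 1}"
    and "invertible (\<Sum>i=1..N. nls_hessian (x i) \<beta>)"
    and "\<beta>' = newton_raphson_step N x y \<beta>"
  shows "\<beta>' =
      matrix_inv ((1 / real N) *\<^sub>R (\<Sum>i=1..N. indicator {0<..<1} (x i \<bullet> \<beta>) *\<^sub>R
          ((columnvector (x i) :: real ^ 1 ^ 'k) ** (rowvector (x i) :: real ^ 'k ^ 1))))
        *v ((1 / real N) *\<^sub>R (\<Sum>i=1..N. (y i * indicator {0<..<1} (x i \<bullet> \<beta>)) *\<^sub>R x i))
    \<and> (\<forall>b. is_ols_estimator {i \<in> {1..N}. x i \<bullet> \<beta> \<in> {0<..<1}} x y b \<longleftrightarrow> b = \<beta>')"
proof -
  let ?H = "\<Sum>i=1..N. nls_hessian (x i) \<beta>"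
  let ?r = "\<Sum>i=1..N. (y i * indicator {0<..<1} (x i \<bullet> \<beta>)) *\<^sub>R x i"
  let ?S = "{i \<in> {1..N}. x i \<bullet> \<beta> \<in> {0<..<1}}"
  \<comment> \<open>For \<open>N = 0\<close> the Hessian is an empty sum, hence singular. This
    matters because \<open>1 / real 0\<close> is 0, and scaling by it would destroy
    invertibility.\<close>
  have "N \<noteq> 0"
  proof
    assume "N = 0"
    then have "invertible (0 :: real ^ 'k ^ 'k)"
      using assms(2) by simp
    then show False
      by (metis det_0 mat_0 invertible_det_nz)
  qed
  then have inv: "invertible ((1 / real N) *\<^sub>R ?H)"
    using assms(2) by (intro scalar_invertible) auto
  have "(\<Sum>i=1..N. nls_score (x i) (y i) \<beta>) = ?H *v \<beta> - ?r"
    by (simp add: nls_score_eq_hessian_residual sum_subtractf sum_matrix_vector_mult)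
  then have "\<beta>' = \<beta> - matrix_inv ((1 / real N) *\<^sub>R ?H)
      *v (((1 / real N) *\<^sub>R ?H) *v \<beta> - (1 / real N) *\<^sub>R ?r)"
    unfolding assms(3) newton_raphson_step_def
    by (simp only: scaleR_diff_right scaleR_matrix_vector_assoc)
  moreover have "matrix_inv ((1 / real N) *\<^sub>R ?H) *v (((1 / real N) *\<^sub>R ?H) *v \<beta>) = \<beta>"
    using matrix_inv_mult_vector_unique[OF inv] by blast
  ultimately have step: "\<beta>' = matrix_inv ((1 / real N) *\<^sub>R ?H) *v ((1 / real N) *\<^sub>R ?r)"
    by (simp only: matrix_vector_mult_diff_distrib diff_diff_eq2 add_diff_cancel_left')
  then have "((1 / real N) *\<^sub>R ?H) *v \<beta>' = (1 / real N) *\<^sub>R ?r"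
    using matrix_inv_mult_vector_unique[OF inv] by blast
  then have "(1 / real N) *\<^sub>R (?H *v \<beta>') = (1 / real N) *\<^sub>R ?r"
    by (simp only: scaleR_matrix_vector_assoc)
  then have normal: "?H *v \<beta>' = ?r"
    using \<open>N \<noteq> 0\<close> by (subst (asm) scaleR_cancel_left) simp
  have "(\<Sum>i\<in>?S. (y i - x i \<bullet> \<beta>') *\<^sub>R x i)
      = (\<Sum>i=1..N. (y i * indicator {0<..<1} (x i \<bullet> \<beta>)) *\<^sub>R x i - nls_hessian (x i) \<beta> *v \<beta>')"
    \<comment> \<open>Outside \<open>?S\<close> the indicator annihilates the right-hand summand, so
      the sum extends to all observations.\<close>
    by (rule sum.mono_neutral_cong_left)
      (auto simp: nls_hessian_mult_vector indicator_def algebra_simps)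
  also have "\<dots> = ?r - ?H *v \<beta>'"
    by (simp only: sum_subtractf sum_matrix_vector_mult)
  also have "\<dots> = 0"
    using normal by simp
  finally have residual: "(\<Sum>i\<in>?S. (y i - x i \<bullet> \<beta>') *\<^sub>R x i) = 0" .
  have "(\<forall>i\<in>?S. x i \<bullet> (b - \<beta>') = 0) \<longleftrightarrow> b = \<beta>'" for b
  proof
    assume "\<forall>i\<in>?S. x i \<bullet> (b - \<beta>') = 0"
    \<comment> \<open>Each active term of \<open>?H\<close> sends \<open>b - \<beta>'\<close> to a
      multiple of \<open>x i\<close> with coefficient \<open>x i \<bullet> (b - \<beta>')\<close>,
      here 0; inactive terms are zero matrices.\<close>
    then have "?H *v (b - \<beta>') = 0"
      by (auto simp: sum_matrix_vector_mult nls_hessian_mult_vector indicator_def intro!: sum.neutral)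
    then have "matrix_inv ?H *v 0 = b - \<beta>'"
      using matrix_inv_mult_vector_unique[OF assms(2)] by blast
    then show "b = \<beta>'"
      by simp
  qed simp
  moreover have "finite ?S"
    by simp
  ultimately have "\<forall>b. is_ols_estimator ?S x y b \<longleftrightarrow> b = \<beta>'"
    using is_ols_estimator_iff_same_fit[OF _ residual] by blast
  with step show ?thesis
    unfolding nls_hessian_def by blast
qed

end
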